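(* Let $\mathbf{w}=w_0w_1\cdots w_n$ be a generalized snake word that is not a ladder word (i.e. both letters $L$ and $R$ occur in $\mathbf{w}$), and let $\mathbf{q}$ be $\varepsilon$ concatenated with the right-most maximal sub-ladder of $\mathbf{w}$. Then $$h^*(\mathbf{w};z)=h^*((\mathbf{w}^* )';z)\cdot h^*(\mathbf{q};z)+h^*(\mathbf{w}^*;z)\cdot h^*(\mathbf{q}';z)-(z+1)\cdot h^*((\mathbf{w}^* )';z)\cdot h^*(\mathbf{q}';z),$$ where $h^*(\varepsilon;z)=z+1$.
   Context: Generalized snake words: for $n\ge 0$, a generalized snake word of length $n$ is $\mathbf{w}=w_0w_1\cdots w_n$ where $w_0=\varepsilon$ is the empty letter and $w_i\in\{L,R\}$ for $1\le i\le n$. A ladder word is one whose letters $w_1,\dots,w_n$ are all equal. Generalized snake posets: $P(\mathbf{w})$ is defined recursively. $P(\varepsilon)$ is the poset on $\{0,1,2,3\}$ with cover relations $1\prec 0$, $2\prec 0$, $3\prec 1$, $3\prec 2$. For $n\ge 1$, $P(w_0w_1\cdots w_n)$ is $P(w_0\cdots w_{n-1})\cup\{2n+2,2n+3\}$ with the added cover relations $2n+3\prec 2n+1$, $2n+3\prec 2n+2$, and: $2n+2\prec 2n-1$ if ($n=1$ and $w_1=L$) or ($n\ge2$ and $w_{n-1}w_n\in\{RL,LR\}$); $2n+2\prec 2n$ if ($n=1$ and $w_1=R$) or ($n\ge 2$ and $w_{n-1}w_n\in\{LL,RR\}$). Order polytope: for a finite poset $P$, $\mathcal{O}(P)=\{x\in[0,1]^P: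 x_i\le x_j \text{ whenever } i<_P j\}\subset\mathbb{R}^P$, a lattice polytope of dimension $|P|$. $h^*$-polynomial: $h^*(\mathbf{w};z)$ is the polynomial defined by $\sum_{t\ge0}|t\,\mathcal{O}(P(\mathbf{w}))\cap\mathbb{Z}^{P(\mathbf{w})}|\,z^t=\dfrac{h^*(\mathbf{w};z)}{(1-z)^{d+1}}$ with $d=|P(\mathbf{w})|$. Subwords: $\mathbf{w}[i:j]=w_iw_{i+1}\cdots w_j$. A subword $\mathbf{w}[i:j]$ with $1\le i\le j$ is a maximal sub-ladder if all its letters are equal, $w_{i-1}\ne w_i$, and $w_j\neq w_{j+1}$ (the last condition being vacuous if $j=n$). For a word $\mathbf{u}=u_0u_1\cdots u_m$ with $m\ge1$, $\mathbf{u}'=\mathbf{u}[0:m-1]$ is the word with the last letter removed. $\mathbf{w}^*=\mathbf{w}[0:i]$, where $\mathbf{w}[i+1:n]$ is the right-most maximal sub-ladder of $\mathbf{w}$. Example: for $\mathbf{w}=\varepsilon RRLLLRRR$ one has $\mathbf{w}'=\varepsilon RRLLLRR$, $\mathbf{w}^*=\varepsilon RRLLL$, $\mathbf{q}=\varepsilon RRR$. *)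

theory Defs
  imports "HOL-Computational_Algebra.Computational_Algebra" "HOL-Library.FuncSet"
begin

text \<open>A word \<open>w\<^sub>0 w\<^sub>1 \<dots> w\<^sub>n\<close> is the list of its letters, including the empty letter
  \<open>w\<^sub>0\<close>, so that \<open>w ! i\<close> is \<open>w\<^sub>i\<close> and the length of the list exceeds that of the word by one.\<close>

datatype letter = Eps | L | R

definition snake_length :: "letter list \<Rightarrow> nat" where
  "snake_length w = length w - 1"

definition snake_word :: "letter list \<Rightarrow> bool" where
  "snake_word w \<longleftrightarrow> w \<noteq> [] \<and> w ! 0 = Eps \<and> (\<forall>i\<in>{1..snake_length w}. w ! i \<in> {L, R})"

definition ladder_word :: "letter list \<Rightarrow> bool" where
  "ladder_word w \<longleftrightarrow> snake_word w \<and>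
     (\<forall>i\<in>{1..snake_length w}. \<forall>j\<in>{1..snake_length w}. w ! i = w ! j)"

definition subword :: "letter list \<Rightarrow> nat \<Rightarrow> nat \<Rightarrow> letter list" where
  "subword w i j = map (nth w) [i..<Suc j]"

definition drop_last :: "letter list \<Rightarrow> letter list" where
  "drop_last u = subword u 0 (snake_length u - 1)"

definition maximal_subladder :: "letter list \<Rightarrow> nat \<Rightarrow> nat \<Rightarrow> bool" where
  "maximal_subladder w i j \<longleftrightarrow>
     1 \<le> i \<and> i \<le> j \<and> j \<le> snake_length w \<and>
     (\<forall>k\<in>{i..j}. \<forall>l\<in>{i..j}. w ! k = w ! l) \<and>
     w ! (i - 1) \<noteq> w ! i \<and>
     (j = snake_length w \<or> w ! j \<noteq> w ! (j + 1))"

definition last_ladder_start :: "letter list \<Rightarrow> nat" where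
  "last_ladder_start w = (GREATEST i. \<exists>j. maximal_subladder w i j)"

definition last_ladder :: "letter list \<Rightarrow> letter list" where
  "last_ladder w = subword w (last_ladder_start w) (snake_length w)"

definition star :: "letter list \<Rightarrow> letter list" where
  "star w = subword w 0 (last_ladder_start w - 1)"

text \<open>A pair \<open>(a, b)\<close> is the relation \<open>a \<prec> b\<close>. The second argument \<open>n\<close> selects the prefix
  \<open>w\<^sub>0 \<dots> w\<^sub>n\<close>.\<close>

fun snake_covers_upto :: "letter list \<Rightarrow> nat \<Rightarrow> (nat \<times> nat) set" where
  "snake_covers_upto w 0 = {(1, 0), (2, 0), (3, 1), (3, 2)}"
| "snake_covers_upto w (Suc m) = (let n = Suc m in
     snake_covers_upto w m
     \<union> {(2 * n + 3, 2 * n + 1), (2 * n + 3, 2 * n + 2)}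
     \<union> (if n = 1 \<and> w ! 1 = L \<or> 2 \<le> n \<and> (w ! (n - 1), w ! n) \<in> {(R, L), (L, R)}
        then {(2 * n + 2, 2 * n - 1)} else {})
     \<union> (if n = 1 \<and> w ! 1 = R \<or> 2 \<le> n \<and> (w ! (n - 1), w ! n) \<in> {(L, L), (R, R)}
        then {(2 * n + 2, 2 * n)} else {}))"

definition snake_carrier :: "letter list \<Rightarrow> nat set" where
  "snake_carrier w = {0..2 * snake_length w + 3}"

definition snake_less :: "letter list \<Rightarrow> (nat \<times> nat) set" where
  "snake_less w = (snake_covers_upto w (snake_length w))\<^sup>+"

text \<open>The space of real vectors indexed by a set \<open>A\<close> is rendered as the functions
  that are extensional on \<open>A\<close>. The relation \<open>r\<close> is the strict order.\<close>

definition order_polytope :: "'a set \<Rightarrow> ('a \<times> 'a) set \<Rightarrow> ('a \<Rightarrow> real) set" where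
  "order_polytope A r = {x \<in> A \<rightarrow>\<^sub>E {0..1}. \<forall>i\<in>A. \<forall>j\<in>A. (i, j) \<in> r \<longrightarrow> x i \<le> x j}"

definition dilate :: "'a set \<Rightarrow> real \<Rightarrow> ('a \<Rightarrow> real) set \<Rightarrow> ('a \<Rightarrow> real) set" where
  "dilate A t S = (\<lambda>x. \<lambda>i\<in>A. t * x i) ` S"

definition lattice_point_count :: "'a set \<Rightarrow> ('a \<Rightarrow> real) set \<Rightarrow> nat \<Rightarrow> nat" where
  "lattice_point_count A S t = card (dilate A (real t) S \<inter> (A \<rightarrow>\<^sub>E \<int>))"

text \<open>The order polytope of a poset \<open>P\<close> has dimension \<open>|P|\<close>, whence the exponent
  \<open>|P| + 1\<close> of the denominator. The description is well defined: the numerator is determined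
  by the series, and it is a polynomial by Ehrhart's theorem.\<close>

definition h_star :: "letter list \<Rightarrow> real poly" where
  "h_star w = (THE h.
     Abs_fps (\<lambda>t. real (lattice_point_count (snake_carrier w)
                      (order_polytope (snake_carrier w) (snake_less w)) t))
     = fps_of_poly h / (1 - fps_X) ^ (card (snake_carrier w) + 1))"

end

theory Submission
  imports Defs
begin

text \<open>The lattice points of the \<open>t\<close>-th dilate of an order polytope are the order-preserving
  labelings of the poset by \<open>0, \<dots>, t\<close>, so everything can be read off from the series that count
  labelings.

  Let \<open>i\<close> be the last index of \<open>w\<^sup>*\<close>. Since the letter after it differs from the letter
  there, the element \<open>a = 2 * i + 1\<close> lies on three consecutive squares and is comparable to every
  element except \<open>b = 2 * i + 2\<close>. Let \<open>U\<close> be the set of elements above \<open>a\<close> and \<open>D\<close> the set of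
  those below. A labeling \<open>f\<close> has \<open>f a \<le> f b\<close> or \<open>f b \<le> f a\<close>, and those with equality are counted
  twice (\<open>order_series_split\<close>). In each of the three cases \<open>a\<close> cuts the poset into an upper and a
  lower part, and series multiply across a cut point (\<open>order_series_ordinal_sum\<close>). Writing \<open>E\<close> for
  the series of an induced subposet, this gives (\<open>zigzag_series_pivot\<close>) \<open>E(P) = E(U \<union> {b}) E(D) +
  E(U) E(D \<union> {b}) - E(U) E(D)\<close>.

  The same formula applies to the two shorter posets that contain the square of \<open>a\<close> and \<open>b\<close>. For
  the poset of \<open>w\<^sup>*\<close> the set \<open>D\<close> is replaced by a point, and for that of \<open>q\<close> the set \<open>U\<close> is.
  In the poset of \<open>(w\<^sup>*)'\<close> the element \<open>a\<close> is the bottom, and in that of \<open>q'\<close> it is the top,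
  so that their series are \<open>E(U)\<close> and \<open>E(D)\<close> divided by \<open>1 - z\<close>. All five series are thus
  expressed by \<open>E(U)\<close>, \<open>E(U \<union> {b})\<close>, \<open>E(D)\<close> and \<open>E(D \<union> {b})\<close>, and after clearing denominators the
  recursion is a polynomial identity in these four.

  To pass from series to \<open>h\<^sup>*\<close>-polynomials one needs that the numerators exist. This follows
  from a recursion that removes the set of elements with the top label
  (\<open>order_series_numerator_exists\<close>).\<close>

section \<open>Labelings of a finite relation and their generating series\<close>

definition labelings :: "'a set \<Rightarrow> ('a \<times> 'a) set \<Rightarrow> nat \<Rightarrow> ('a \<Rightarrow> nat) set" where
  "labelings A r t = {f \<in> A \<rightarrow>\<^sub>E {..t}. \<forall>i\<in>A. \<forall>j\<in>A. (i, j) \<in> r \<longrightarrow> f i \<le> f j}"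

text \<open>The Ehrhart series of the order polytope of \<open>(A, r)\<close>. The relation need not be transitive,
  so that single relations can be added to an order, and only its part on \<open>A\<close> matters, so that
  passing to an induced subposet only changes \<open>A\<close>.\<close>

definition order_series :: "'a set \<Rightarrow> ('a \<times> 'a) set \<Rightarrow> real fps" where
  "order_series A r = Abs_fps (\<lambda>t. real (card (labelings A r t)))"

lemma finite_labelings [simp]: "finite A \<Longrightarrow> finite (labelings A r t)"
  by (rule finite_subset[of _ "A \<rightarrow>\<^sub>E {..t}"]) (auto simp: labelings_def intro: finite_PiE)

lemma labelings_outside: "f \<in> labelings A r t \<Longrightarrow> x \<notin> A \<Longrightarrow> f x = undefined"
  by (auto simp: labelings_def PiE_def extensional_def)

lemma order_series_nth: "order_series A r $ t = real (card (labelings A r t))"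
  by (simp add: order_series_def)

lemma order_series_cong:
  assumes "\<And>x y. x \<in> A \<Longrightarrow> y \<in> A \<Longrightarrow> (x, y) \<in> r \<longleftrightarrow> (x, y) \<in> s"
  shows "order_series A r = order_series A s"
proof -
  have "labelings A r t = labelings A s t" for t
    using assms by (auto simp: labelings_def)
  then show ?thesis by (simp add: order_series_def)
qed

lemma order_series_iso:
  assumes bij: "bij_betw \<phi> A B"
    and rel: "\<And>x y. x \<in> A \<Longrightarrow> y \<in> A \<Longrightarrow> (x, y) \<in> r \<longleftrightarrow> (\<phi> x, \<phi> y) \<in> s"
  shows "order_series A r = order_series B s"
proof -
  define \<psi> where "\<psi> = inv_into A \<phi>"
  have \<psi>: "\<psi> y \<in> A" "\<phi> (\<psi> y) = y" if "y \<in> B" for y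
    using that bij unfolding \<psi>_def
    by (auto simp: bij_betw_def inv_into_into f_inv_into_f)
  have \<phi>: "\<phi> x \<in> B" "\<psi> (\<phi> x) = x" if "x \<in> A" for x
    using that bij unfolding \<psi>_def by (auto simp: bij_betw_def)
  have "bij_betw (\<lambda>f. \<lambda>y\<in>B. f (\<psi> y)) (labelings A r t) (labelings B s t)" for t
  proof (rule bij_betw_byWitness[where f' = "\<lambda>g. \<lambda>x\<in>A. g (\<phi> x)"])
    show "\<forall>f\<in>labelings A r t. (\<lambda>x\<in>A. (\<lambda>y\<in>B. f (\<psi> y)) (\<phi> x)) = f"
      using \<phi> by (auto simp: fun_eq_iff restrict_def labelings_outside)
    show "\<forall>g\<in>labelings B s t. (\<lambda>y\<in>B. (\<lambda>x\<in>A. g (\<phi> x)) (\<psi> y)) = g"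
      using \<psi> by (auto simp: fun_eq_iff restrict_def labelings_outside)
    show "(\<lambda>f. \<lambda>y\<in>B. f (\<psi> y)) ` labelings A r t \<subseteq> labelings B s t"
      using \<psi> rel by (fastforce simp: labelings_def PiE_iff)
    show "(\<lambda>g. \<lambda>x\<in>A. g (\<phi> x)) ` labelings B s t \<subseteq> labelings A r t"
      using \<phi> rel by (fastforce simp: labelings_def PiE_iff)
  qed
  then have "card (labelings A r t) = card (labelings B s t)" for t
    by (rule bij_betw_same_card)
  then show ?thesis by (simp add: order_series_def)
qed

text \<open>A labeling with top value \<open>t + 1\<close> is determined by the set \<open>I\<close> on which this value is taken
  and by its restriction to the complement, which is a labeling with top value \<open>t\<close>. The sets that
  occur are those closed upwards under \<open>r\<close>.\<close>

lemma card_labelings_Suc: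
  assumes "finite A"
  shows "card (labelings A r (Suc t)) =
    (\<Sum>I | I \<subseteq> A \<and> (\<forall>x\<in>I. \<forall>y\<in>A. (x, y) \<in> r \<longrightarrow> y \<in> I). card (labelings (A - I) r t))"
    (is "_ = sum _ ?F")
proof -
  have fin: "finite ?F" by (rule finite_subset[of _ "Pow A"]) (use assms in auto)
  have "bij_betw (\<lambda>(I, g). \<lambda>x\<in>A. if x \<in> I then Suc t else g x)
     (SIGMA I:?F. labelings (A - I) r t) (labelings A r (Suc t))"
  proof (rule bij_betw_byWitness[where f' = "\<lambda>f. ({x\<in>A. f x = Suc t}, \<lambda>x\<in>A - {x\<in>A. f x = Suc t}. f x)"])
    show "\<forall>p\<in>(SIGMA I:?F. labelings (A - I) r t).
       (\<lambda>f. ({x\<in>A. f x = Suc t}, \<lambda>x\<in>A - {x\<in>A. f x = Suc t}. f x))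
         ((\<lambda>(I, g). \<lambda>x\<in>A. if x \<in> I then Suc t else g x) p) = p"
    proof
      fix p assume "p \<in> (SIGMA I:?F. labelings (A - I) r t)"
      then obtain I g where p: "p = (I, g)" and I: "I \<subseteq> A" and g: "g \<in> labelings (A - I) r t"
        by blast
      have lt: "g x \<noteq> Suc t" if "x \<in> A" "x \<notin> I" for x
        using g that by (force simp: labelings_def PiE_iff)
      have "(\<lambda>x\<in>A - I. if x \<in> I then Suc t else g x) = g"
        using labelings_outside[OF g] by (auto simp: fun_eq_iff restrict_def)
      moreover have "(\<lambda>x\<in>A - I. (\<lambda>x\<in>A. if x \<in> I then Suc t else g x) x)
          = (\<lambda>x\<in>A - I. if x \<in> I then Suc t else g x)"
        by (auto simp: fun_eq_iff restrict_def)
      moreover have "{x\<in>A. (\<lambda>x\<in>A. if x \<in> I then Suc t else g x) x = Suc t} = I"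
        using I lt by (auto split: if_splits)
      ultimately show "(\<lambda>f. ({x\<in>A. f x = Suc t}, \<lambda>x\<in>A - {x\<in>A. f x = Suc t}. f x))
         ((\<lambda>(I, g). \<lambda>x\<in>A. if x \<in> I then Suc t else g x) p) = p"
        unfolding p by simp
    qed
    show "\<forall>f\<in>labelings A r (Suc t). (\<lambda>(I, g). \<lambda>x\<in>A. if x \<in> I then Suc t else g x)
       ({x\<in>A. f x = Suc t}, \<lambda>x\<in>A - {x\<in>A. f x = Suc t}. f x) = f"
      by (auto simp: fun_eq_iff restrict_def labelings_outside)
    show "(\<lambda>(I, g). \<lambda>x\<in>A. if x \<in> I then Suc t else g x) ` (SIGMA I:?F. labelings (A - I) r t)
        \<subseteq> labelings A r (Suc t)"
    proof (rule image_subsetI)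
      fix p assume "p \<in> (SIGMA I:?F. labelings (A - I) r t)"
      then obtain I g where p: "p = (I, g)" and I: "I \<subseteq> A"
          "\<forall>x\<in>I. \<forall>y\<in>A. (x, y) \<in> r \<longrightarrow> y \<in> I"
        and g: "g \<in> labelings (A - I) r t"
        by blast
      have le: "g x \<le> t" if "x \<in> A" "x \<notin> I" for x
        using g that by (auto simp: labelings_def PiE_iff)
      show "(\<lambda>(I, g). \<lambda>x\<in>A. if x \<in> I then Suc t else g x) p \<in> labelings A r (Suc t)"
        using I g le unfolding p by (auto simp: labelings_def PiE_iff le_SucI)
    qed
    show "(\<lambda>f. ({x\<in>A. f x = Suc t}, \<lambda>x\<in>A - {x\<in>A. f x = Suc t}. f x)) ` labelings A r (Suc t)
       \<subseteq> (SIGMA I:?F. labelings (A - I) r t)"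
    proof (rule image_subsetI)
      fix f assume f: "f \<in> labelings A r (Suc t)"
      have le: "f x \<le> Suc t" if "x \<in> A" for x using f that by (auto simp: labelings_def PiE_iff)
      have "f y = Suc t" if "x \<in> A" "y \<in> A" "f x = Suc t" "(x, y) \<in> r" for x y
        using f that le[OF \<open>y \<in> A\<close>] by (force simp: labelings_def)
      moreover have "(\<lambda>x\<in>A - {x\<in>A. f x = Suc t}. f x) \<in> labelings (A - {x\<in>A. f x = Suc t}) r t"
        using f le by (auto simp: labelings_def PiE_iff le_Suc_eq)
      ultimately show "({x\<in>A. f x = Suc t}, \<lambda>x\<in>A - {x\<in>A. f x = Suc t}. f x)
          \<in> (SIGMA I:?F. labelings (A - I) r t)"
        by blast
    qed
  qed
  from bij_betw_same_card[OF this] show ?thesis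
    using fin assms by (simp add: card_SigmaI)
qed

lemma labelings_0: "labelings A r 0 = {\<lambda>x\<in>A. 0}"
  by (auto simp: labelings_def PiE_iff fun_eq_iff extensional_def)

text \<open>The case \<open>I = {}\<close> of the recursion on the top value reproduces the series itself; moving it
  to the left leaves only smaller ground sets on the right.\<close>

lemma order_series_rec:
  assumes "finite A"
  shows "(1 - fps_X) * order_series A r = 1 + fps_X *
    (\<Sum>I | I \<subseteq> A \<and> I \<noteq> {} \<and> (\<forall>x\<in>I. \<forall>y\<in>A. (x, y) \<in> r \<longrightarrow> y \<in> I). order_series (A - I) r)"
    (is "_ = 1 + fps_X * sum _ ?F")
proof -
  have fin: "finite ?F" by (rule finite_subset[of _ "Pow A"]) (use assms in auto)
  have F: "{I. I \<subseteq> A \<and> (\<forall>x\<in>I. \<forall>y\<in>A. (x, y) \<in> r \<longrightarrow> y \<in> I)} = insert {} ?F" by auto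
  have "order_series A r = 1 + fps_X * (order_series A r + (\<Sum>I\<in>?F. order_series (A - I) r))"
  proof (rule fps_ext)
    fix t show "order_series A r $ t =
      (1 + fps_X * (order_series A r + (\<Sum>I\<in>?F. order_series (A - I) r))) $ t"
    proof (cases t)
      case 0 then show ?thesis by (simp add: order_series_nth labelings_0)
    next
      case (Suc s)
      then show ?thesis
        using fin by (simp add: order_series_nth card_labelings_Suc[OF assms] F fps_sum_nth)
    qed
  qed
  then show ?thesis by (simp add: algebra_simps)
qed

lemma fps_of_poly_one_minus_X: "fps_of_poly [:1, -1:] = 1 - (fps_X :: real fps)"
  by (simp add: fps_of_poly_pCons algebra_simps)

text \<open>Each nonempty \<open>I\<close> in the recursion removes at least one element, hence at least one factor
  \<open>1 - z\<close> from the denominator. This is the part of Ehrhart's theorem that makes the definition of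
  \<open>h_star\<close> meaningful.\<close>

lemma order_series_numerator_exists:
  assumes "finite A"
  shows "\<exists>h. order_series A r * (1 - fps_X) ^ (card A + 1) = fps_of_poly h"
  using assms
proof (induction A rule: finite_psubset_induct)
  case (psubset A)
  let ?F = "{I. I \<subseteq> A \<and> I \<noteq> {} \<and> (\<forall>x\<in>I. \<forall>y\<in>A. (x, y) \<in> r \<longrightarrow> y \<in> I)}"
  have "\<forall>I\<in>?F. \<exists>h. order_series (A - I) r * (1 - fps_X) ^ card A = fps_of_poly h"
  proof
    fix I assume I: "I \<in> ?F"
    then have "A - I \<subset> A" by auto
    then obtain h where h: "order_series (A - I) r * (1 - fps_X) ^ (card (A - I) + 1) = fps_of_poly h"
      using psubset.IH by blast
    have lt: "card (A - I) < card A"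
      using \<open>A - I \<subset> A\<close> psubset.hyps by (rule psubset_card_mono[rotated])
    have "order_series (A - I) r * (1 - fps_X) ^ card A
      = order_series (A - I) r * (1 - fps_X) ^ (card (A - I) + 1) * (1 - fps_X) ^ (card A - (card (A - I) + 1))"
      using lt by (simp add: mult.assoc flip: power_add power_Suc)
    also have "\<dots> = fps_of_poly (h * [:1, -1:] ^ (card A - (card (A - I) + 1)))"
      by (simp only: h fps_of_poly_mult fps_of_poly_power fps_of_poly_one_minus_X)
    finally show "\<exists>h. order_series (A - I) r * (1 - fps_X) ^ card A = fps_of_poly h" by blast
  qed
  from bchoice[OF this] obtain h
    where h: "\<forall>I\<in>?F. order_series (A - I) r * (1 - fps_X) ^ card A = fps_of_poly (h I)" ..
  have "order_series A r * (1 - fps_X) ^ (card A + 1)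
    = ((1 - fps_X) * order_series A r) * (1 - fps_X) ^ card A" by (simp add: mult_ac)
  also have "\<dots> = (1 - fps_X) ^ card A + fps_X * (\<Sum>I\<in>?F. order_series (A - I) r * (1 - fps_X) ^ card A)"
    by (simp only: order_series_rec[OF psubset.hyps] distrib_right sum_distrib_right mult.assoc mult_1)
  also have "\<dots> = fps_of_poly ([:1, -1:] ^ card A + [:0, 1:] * (\<Sum>I\<in>?F. h I))"
    using h by (simp add: fps_of_poly_add fps_of_poly_mult fps_of_poly_power fps_of_poly_one_minus_X
      fps_of_poly_sum del: mult_pCons_left)
  finally show ?case by blast
qed

lemma order_series_empty: "order_series {} r = inverse (1 - fps_X)"
  using order_series_rec[of "{}" r] by (intro fps_inverse_unique[symmetric]) (simp cong: conj_cong)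

text \<open>If a point \<open>a\<close> lies below all of \<open>X\<close> and above all of \<open>Y\<close>, then fixing its label \<open>s\<close> leaves
  an independent choice of labels at most \<open>s\<close> on \<open>Y\<close> and at least \<open>s\<close> on \<open>X\<close>. Summation over \<open>s\<close>
  is exactly the Cauchy product, so that the two series multiply without a correction factor.\<close>

lemma order_series_ordinal_sum:
  assumes fin: "finite X" "finite Y" and disj: "X \<inter> Y = {}" "a \<notin> X" "a \<notin> Y"
    and aX: "\<And>x. x \<in> X \<Longrightarrow> (a, x) \<in> r" and Ya: "\<And>y. y \<in> Y \<Longrightarrow> (y, a) \<in> r"
    and no: "\<And>x. x \<in> X \<Longrightarrow> (x, a) \<notin> r" "\<And>y. y \<in> Y \<Longrightarrow> (a, y) \<notin> r"
      "\<And>x y. x \<in> X \<Longrightarrow> y \<in> Y \<Longrightarrow> (x, y) \<notin> r"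
    and A: "A = X \<union> {a} \<union> Y"
  shows "order_series A r = order_series X r * order_series Y r"
proof -
  have *: "card (labelings A r t) = (\<Sum>s\<le>t. card (labelings Y r s) * card (labelings X r (t - s)))" for t
  proof -
    let ?S = "SIGMA s:{..t}. labelings Y r s \<times> labelings X r (t - s)"
    let ?c = "\<lambda>(s, g, h). \<lambda>x\<in>A. if x = a then s else if x \<in> Y then g x else s + h x"
    let ?d = "\<lambda>f. (f a, \<lambda>y\<in>Y. f y, \<lambda>x\<in>X. f x - f a)"
    have ge: "f a \<le> f x" if "f \<in> labelings A r t" "x \<in> X" for f x
      using that aX by (auto simp: labelings_def A)
    have le: "f y \<le> f a" if "f \<in> labelings A r t" "y \<in> Y" for f y
      using that Ya by (auto simp: labelings_def A)
    have "bij_betw ?c ?S (labelings A r t)"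
    proof (rule bij_betw_byWitness[where f' = ?d])
      show "\<forall>p\<in>?S. ?d (?c p) = p"
        using disj by (auto simp: A fun_eq_iff restrict_def labelings_outside)
      show "\<forall>f\<in>labelings A r t. ?c (?d f) = f"
        using disj ge by (auto simp: A fun_eq_iff restrict_def labelings_outside)
      show "?c ` ?S \<subseteq> labelings A r t"
      proof (rule image_subsetI)
        fix p assume "p \<in> ?S"
        then obtain s g h where p: "p = (s, g, h)" and s: "s \<in> {..t}"
          and g: "g \<in> labelings Y r s" and h: "h \<in> labelings X r (t - s)"
          by blast
        have gs: "g y \<le> s" if "y \<in> Y" for y using g that by (auto simp: labelings_def PiE_iff)
        have hs: "s + h x \<le> t" if "x \<in> X" for x
          using h s that by (fastforce simp: labelings_def PiE_iff)
        have g': "g x \<le> g y" if "x \<in> Y" "y \<in> Y" "(x, y) \<in> r" for x y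
          using g that by (auto simp: labelings_def)
        have h': "h x \<le> h y" if "x \<in> X" "y \<in> X" "(x, y) \<in> r" for x y
          using h that by (auto simp: labelings_def)
        show "?c p \<in> labelings A r t"
        proof -
          define c where "c = ?c p"
          have ca: "c a = s" and cX: "\<And>x. x \<in> X \<Longrightarrow> c x = s + h x"
            and cY: "\<And>y. y \<in> Y \<Longrightarrow> c y = g y" and ext: "c \<in> extensional A"
            using disj by (auto simp: p A c_def)
          have A_cases: "x \<in> A \<longleftrightarrow> x = a \<or> x \<in> X \<or> x \<in> Y" for x
            by (auto simp: A)
          have "c x \<le> t" if "x \<in> A" for x
            using that s hs le_trans[OF gs] unfolding A_cases by (auto simp: ca cX cY)
          moreover have "c x \<le> c y" if "x \<in> A" "y \<in> A" "(x, y) \<in> r" for x y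
            using that no g' h' gs trans_le_add1[OF gs] unfolding A_cases
            by (elim disjE) (simp_all add: ca cX cY)
          ultimately show ?thesis
            using ext unfolding c_def[symmetric] by (simp add: labelings_def PiE_iff)
        qed
      qed
      show "?d ` labelings A r t \<subseteq> ?S"
      proof (rule image_subsetI)
        fix f assume f: "f \<in> labelings A r t"
        have "f a \<in> {..t}" using f by (auto simp: labelings_def A PiE_iff)
        moreover have "(\<lambda>y\<in>Y. f y) \<in> labelings Y r (f a)"
          using f le[OF f] by (auto simp: labelings_def A PiE_iff)
        moreover have "(\<lambda>x\<in>X. f x - f a) \<in> labelings X r (t - f a)"
          using f ge[OF f] by (auto simp: labelings_def A PiE_iff diff_le_mono)
        ultimately show "?d f \<in> ?S" by blast
      qed
    qed
    from bij_betw_same_card[OF this] show ?thesis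
      using fin by (simp add: card_SigmaI card_cartesian_product)
  qed
  show ?thesis
    by (rule fps_ext, subst mult.commute)
      (simp add: order_series_nth * fps_mult_nth atMost_atLeast0)
qed

text \<open>Every labeling satisfies \<open>f a \<le> f b\<close> or \<open>f b \<le> f a\<close>, and inclusion-exclusion subtracts those
  with \<open>f a = f b\<close>. When all relations of \<open>b\<close> are shared by \<open>a\<close>, the latter are the labelings of
  the relation with \<open>b\<close> deleted.\<close>

lemma order_series_split:
  assumes fin: "finite A" and ab: "a \<in> A" "b \<in> A" "a \<noteq> b" and bb: "(b, b) \<notin> r"
    and up: "\<And>x. x \<in> A \<Longrightarrow> (b, x) \<in> r \<Longrightarrow> x \<noteq> a \<and> (a, x) \<in> r"
    and down: "\<And>x. x \<in> A \<Longrightarrow> (x, b) \<in> r \<Longrightarrow> x \<noteq> a \<and> (x, a) \<in> r"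
  shows "order_series A r = order_series A (insert (a, b) r) + order_series A (insert (b, a) r)
     - order_series (A - {b}) r"
proof (rule fps_ext)
  fix t
  let ?N1 = "labelings A (insert (a, b) r) t" and ?N2 = "labelings A (insert (b, a) r) t"
  have N1: "?N1 = {f \<in> labelings A r t. f a \<le> f b}" and N2: "?N2 = {f \<in> labelings A r t. f b \<le> f a}"
    using ab by (auto simp: labelings_def)
  have un: "labelings A r t = ?N1 \<union> ?N2" unfolding N1 N2 by auto
  have "bij_betw (\<lambda>f. restrict f (A - {b})) (?N1 \<inter> ?N2) (labelings (A - {b}) r t)"
  proof (rule bij_betw_byWitness[where f' = "\<lambda>g. g(b := g a)"])
    show "\<forall>f\<in>?N1 \<inter> ?N2. (restrict f (A - {b}))(b := restrict f (A - {b}) a) = f"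
      using ab unfolding N1 N2 by (auto simp: fun_eq_iff restrict_def labelings_outside)
    show "\<forall>g\<in>labelings (A - {b}) r t. restrict (g(b := g a)) (A - {b}) = g"
      by (auto simp: fun_eq_iff restrict_def labelings_outside)
    show "(\<lambda>f. restrict f (A - {b})) ` (?N1 \<inter> ?N2) \<subseteq> labelings (A - {b}) r t"
      by (auto simp: labelings_def PiE_iff split: if_splits)
    show "(\<lambda>g. g(b := g a)) ` labelings (A - {b}) r t \<subseteq> ?N1 \<inter> ?N2"
      unfolding N1 N2 using ab up down bb by (auto simp: labelings_def PiE_iff extensional_def)
  qed
  from bij_betw_same_card[OF this]
  have "card (labelings A r t) + card (labelings (A - {b}) r t) = card ?N1 + card ?N2"
    using card_Un_Int[of ?N1 ?N2] fin un by simp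
  then have "real (card (labelings A r t)) + real (card (labelings (A - {b}) r t)) = real (card ?N1) + real (card ?N2)"
    by (metis of_nat_add)
  then show "order_series A r $ t = (order_series A (insert (a, b) r) + order_series A (insert (b, a) r)
     - order_series (A - {b}) r) $ t"
    by (simp add: order_series_nth)
qed

section \<open>Order polytopes and their numerators\<close>

lemma lattice_point_count_order_polytope:
  "lattice_point_count A (order_polytope A r) t = card (labelings A r t)"
proof -
  let ?Q = "dilate A (real t) (order_polytope A r) \<inter> (A \<rightarrow>\<^sub>E \<int>)"
  have "bij_betw (\<lambda>f. \<lambda>i\<in>A. real (f i)) (labelings A r t) ?Q"
  proof (rule bij_betw_byWitness[where f' = "\<lambda>y. \<lambda>i\<in>A. nat \<lfloor>y i\<rfloor>"])
    show "\<forall>f\<in>labelings A r t. (\<lambda>i\<in>A. nat \<lfloor>(\<lambda>i\<in>A. real (f i)) i\<rfloor>) = f"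
      by (auto simp: fun_eq_iff restrict_def labelings_outside)
    have Q: "y i \<in> \<int>" "0 \<le> y i" "y i \<le> real t" if "y \<in> ?Q" "i \<in> A" for y i
      using that by (auto simp: dilate_def order_polytope_def PiE_iff mult_left_le)
    have Qm: "y i \<le> y j" if "y \<in> ?Q" "i \<in> A" "j \<in> A" "(i, j) \<in> r" for y i j
      using that by (auto simp: dilate_def order_polytope_def mult_left_mono)
    show "\<forall>y\<in>?Q. (\<lambda>i\<in>A. real ((\<lambda>i\<in>A. nat \<lfloor>y i\<rfloor>) i)) = y"
    proof
      fix y assume y: "y \<in> ?Q"
      have "real (nat \<lfloor>y i\<rfloor>) = y i" if "i \<in> A" for i
        using Q[OF y that] by (auto elim!: Ints_cases)
      moreover have "y i = undefined" if "i \<notin> A" for i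
        using y that by (auto simp: PiE_iff extensional_def)
      ultimately show "(\<lambda>i\<in>A. real ((\<lambda>i\<in>A. nat \<lfloor>y i\<rfloor>) i)) = y"
        by (auto simp: fun_eq_iff restrict_def)
    qed
    show "(\<lambda>f. \<lambda>i\<in>A. real (f i)) ` labelings A r t \<subseteq> ?Q"
    proof safe
      fix f assume f: "f \<in> labelings A r t"
      \<comment> \<open>For \<open>t = 0\<close> the quotient is \<open>0\<close> by convention, which is right because all labels vanish.\<close>
      let ?x = "\<lambda>i\<in>A. real (f i) / real t"
      have "?x \<in> order_polytope A r"
        using f by (auto simp: order_polytope_def labelings_def PiE_iff divide_simps)
      moreover have "(\<lambda>i\<in>A. real (f i)) = (\<lambda>i\<in>A. real t * ?x i)"
        using f by (auto simp: fun_eq_iff restrict_def labelings_def PiE_iff)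
      ultimately show "(\<lambda>i\<in>A. real (f i)) \<in> dilate A (real t) (order_polytope A r)"
        unfolding dilate_def by blast
    qed auto
    show "(\<lambda>y. \<lambda>i\<in>A. nat \<lfloor>y i\<rfloor>) ` ?Q \<subseteq> labelings A r t"
    proof
      fix g assume "g \<in> (\<lambda>y. \<lambda>i\<in>A. nat \<lfloor>y i\<rfloor>) ` ?Q"
      then obtain y where g: "g = (\<lambda>i\<in>A. nat \<lfloor>y i\<rfloor>)" and y: "y \<in> ?Q" by blast
      have "nat \<lfloor>y i\<rfloor> \<le> t" if "i \<in> A" for i using Q[OF y that] by (simp add: floor_le_iff nat_le_iff)
      moreover have "nat \<lfloor>y i\<rfloor> \<le> nat \<lfloor>y j\<rfloor>" if "i \<in> A" "j \<in> A" "(i, j) \<in> r" for i j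
        using Qm[OF y that] by (intro nat_mono floor_mono)
      ultimately show "g \<in> labelings A r t" by (auto simp: g labelings_def)
    qed
  qed
  from bij_betw_same_card[OF this] show ?thesis by (simp add: lattice_point_count_def)
qed

lemma h_star_eq:
  "fps_of_poly (h_star w) = order_series (snake_carrier w) (snake_less w)
     * (1 - fps_X) ^ (card (snake_carrier w) + 1)"
proof -
  let ?E = "order_series (snake_carrier w) (snake_less w)"
  let ?g = "(1 - fps_X) ^ (card (snake_carrier w) + 1) :: real fps"
  obtain h where h: "?E * ?g = fps_of_poly h"
    using order_series_numerator_exists[of "snake_carrier w"] by (auto simp: snake_carrier_def)
  have unit: "inverse ?g * ?g = 1" by (rule inverse_mult_eq_1) simp
  have iff: "?E = fps_of_poly p / ?g \<longleftrightarrow> ?E * ?g = fps_of_poly p" for p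
  proof -
    have div: "fps_of_poly p / ?g = fps_of_poly p * inverse ?g"
      by (rule fps_divide_unit) simp
    show ?thesis
    proof
      assume "?E = fps_of_poly p / ?g"
      then show "?E * ?g = fps_of_poly p" by (simp only: div mult.assoc unit mult_1_right)
    next
      assume "?E * ?g = fps_of_poly p"
      then have "fps_of_poly p * inverse ?g = ?E * ?g * inverse ?g" by (rule arg_cong[OF sym])
      also have "\<dots> = ?E * (inverse ?g * ?g)"
        by (subst mult.commute[of "inverse ?g"]) (rule mult.assoc)
      finally show "?E = fps_of_poly p / ?g" by (simp only: div unit mult_1_right)
    qed
  qed
  have "h_star w = h"
    unfolding h_star_def lattice_point_count_order_polytope order_series_def[symmetric] iff
    using h by (auto simp: fps_of_poly_eq_iff)
  then show ?thesis using h by simp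
qed

section \<open>Snake posets as zigzags\<close>

text \<open>As in the covers of a snake poset, a pair \<open>(x, y)\<close> puts \<open>x\<close> below \<open>y\<close>. The poset is a chain
  of squares, numbered by \<open>m \<le> n\<close>; square \<open>m\<close> has the bottom \<open>2 * m + 3\<close> and the middle elements
  \<open>2 * m + 1\<close> and \<open>2 * m + 2\<close>. The letters enter only through \<open>\<beta> m\<close>, which tells along which lower
  edge of square \<open>m - 1\<close> the square \<open>m\<close> is glued: its top is \<open>2 * m - 1\<close> or \<open>2 * m\<close>.\<close>

definition zigzag :: "(nat \<Rightarrow> bool) \<Rightarrow> nat \<Rightarrow> (nat \<times> nat) set" where
  "zigzag \<beta> n = {(1, 0), (2, 0)} \<union> (\<Union>m\<in>{..n}. {(2 * m + 3, 2 * m + 1), (2 * m + 3, 2 * m + 2)})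
     \<union> (\<Union>m\<in>{1..n}. {(2 * m + 2, if \<beta> m then 2 * m - 1 else 2 * m)})"

text \<open>For \<open>m = 1\<close> there is no preceding letter to compare with: the two choices are mirror images,
  and \<open>L\<close> is the one that hangs the new element below \<open>1\<close>.\<close>

definition bends :: "letter list \<Rightarrow> nat \<Rightarrow> bool" where
  "bends w m \<longleftrightarrow> (if m = 1 then w ! 1 = L else w ! m \<noteq> w ! (m - 1))"

lemma zigzag_0: "zigzag \<beta> 0 = {(1, 0), (2, 0), (3, 1), (3, 2)}"
  by (auto simp: zigzag_def)

lemma zigzag_Suc:
  "zigzag \<beta> (Suc m) = zigzag \<beta> m \<union> {(2 * m + 5, 2 * m + 3), (2 * m + 5, 2 * m + 4)}
     \<union> {(2 * m + 4, if \<beta> (Suc m) then 2 * m + 1 else 2 * m + 2)}"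
proof -
  have e: "2 * Suc m = 2 * m + 2" "2 * m + 2 + 3 = 2 * m + 5" "2 * m + 2 + 1 = 2 * m + 3"
    "2 * m + 2 + 2 = 2 * m + 4" "2 * m + 2 - 1 = 2 * m + 1" by simp_all
  have "{1..Suc m} = insert (Suc m) {1..m}" by (simp add: atLeastAtMostSuc_conv)
  then show ?thesis
    unfolding zigzag_def atMost_Suc by (simp only: UN_insert e Un_ac)
qed

lemma snake_covers_upto_eq_zigzag:
  assumes "snake_word w" "m \<le> snake_length w"
  shows "snake_covers_upto w m = zigzag (bends w) m"
  using assms(2)
proof (induction m)
  case 0
  then show ?case by (auto simp: zigzag_def)
next
  case (Suc m)
  have "w ! Suc m \<in> {L, R}" "m > 0 \<Longrightarrow> w ! m \<in> {L, R}"
    using assms(1) Suc.prems by (auto simp: snake_word_def)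
  then show ?case using Suc
    by (cases "m = 0") (auto simp: zigzag_Suc bends_def Let_def numeral_eq_Suc)
qed

lemma zigzag_mono: "m \<le> n \<Longrightarrow> zigzag \<beta> m \<subseteq> zigzag \<beta> n"
  by (induction n rule: dec_induct) (auto simp: zigzag_Suc)

lemma zigzag_decreasing: "(x, y) \<in> zigzag \<beta> n \<Longrightarrow> y < x"
  by (auto simp: zigzag_def split: if_splits)

lemma zigzag_trancl_decreasing: "(x, y) \<in> (zigzag \<beta> n)\<^sup>+ \<Longrightarrow> y < x"
  by (induction rule: trancl_induct) (auto dest: zigzag_decreasing)

text \<open>Along a path that ascends in the order the numbers decrease. Therefore the order among the
  elements up to \<open>2 * m + 3\<close> involves only the first squares.\<close>

lemma zigzag_trancl_le:
  assumes "(x, y) \<in> (zigzag \<beta> n)\<^sup>+" "x \<le> 2 * m + 3"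
    and "m \<le> n" "\<And>j. 1 \<le> j \<Longrightarrow> j \<le> m \<Longrightarrow> \<beta> j = \<gamma> j"
  shows "(x, y) \<in> (zigzag \<gamma> m)\<^sup>+"
proof -
  have covers: "(u, v) \<in> zigzag \<gamma> m" if "(u, v) \<in> zigzag \<beta> n" "u \<le> 2 * m + 3" for u v
    using that assms(4) by (auto simp: zigzag_def)
  show ?thesis using assms(1)
  proof (induction rule: trancl_induct)
    case (base y)
    then show ?case using covers assms(2) by auto
  next
    case (step y z)
    have "y < x" using step(1) by (rule zigzag_trancl_decreasing)
    then show ?case using step.IH step(2) assms(2) covers[of y z]
      by (meson trancl.trancl_into_trancl less_imp_le order_trans)
  qed
qed

text \<open>Series of induced subposets of a zigzag: the strict order is formed in the whole zigzag and
  then restricted to \<open>S\<close>.\<close>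

abbreviation zigzag_series :: "(nat \<Rightarrow> bool) \<Rightarrow> nat \<Rightarrow> nat set \<Rightarrow> real fps" where
  "zigzag_series \<beta> n S \<equiv> order_series S ((zigzag \<beta> n)\<^sup>+)"

lemma zigzag_series_prefix:
  assumes "S \<subseteq> {..2 * m + 3}" "m \<le> n" "\<And>j. 1 \<le> j \<Longrightarrow> j \<le> m \<Longrightarrow> \<beta> j = \<gamma> j"
  shows "zigzag_series \<beta> n S = zigzag_series \<gamma> m S"
proof (rule order_series_cong)
  fix x y assume "x \<in> S"
  have sub: "zigzag \<gamma> m \<subseteq> zigzag \<beta> n" using assms(2,3) by (fastforce simp: zigzag_def)
  show "(x, y) \<in> (zigzag \<beta> n)\<^sup>+ \<longleftrightarrow> (x, y) \<in> (zigzag \<gamma> m)\<^sup>+"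
    using zigzag_trancl_le[of x y \<beta> n m \<gamma>] assms \<open>x \<in> S\<close> trancl_mono[OF _ sub] by blast
qed

text \<open>A path between two elements of an interval of numbers stays in that interval, so that there
  the covers alone give the same labelings as the order.\<close>

lemma zigzag_series_interval: "zigzag_series \<beta> n {l..h} = order_series {l..h} (zigzag \<beta> n)"
proof -
  let ?r = "zigzag \<beta> n"
  have mono: "f x \<le> f y" if f: "f \<in> labelings {l..h} ?r t" and xy: "(x, y) \<in> ?r\<^sup>+" and "x \<le> h" "l \<le> y" for f t x y
    using xy \<open>l \<le> y\<close>
  proof (induction rule: trancl_induct)
    case (base y)
    then show ?case using f \<open>x \<le> h\<close> zigzag_decreasing[OF base(1)] by (auto simp: labelings_def)
  next
    case (step y z)
    have "z < y" "y < x" using step(1,2) by (auto dest: zigzag_decreasing zigzag_trancl_decreasing)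
    then have "f x \<le> f y" "f y \<le> f z"
      using step f \<open>x \<le> h\<close> by (auto simp: labelings_def)
    then show ?case by simp
  qed
  have "labelings {l..h} (?r\<^sup>+) t = labelings {l..h} ?r t" for t
  proof
    show "labelings {l..h} (?r\<^sup>+) t \<subseteq> labelings {l..h} ?r t" by (auto simp: labelings_def)
    show "labelings {l..h} ?r t \<subseteq> labelings {l..h} (?r\<^sup>+) t"
    proof
      fix f assume f: "f \<in> labelings {l..h} ?r t"
      then show "f \<in> labelings {l..h} (?r\<^sup>+) t"
        using mono[OF f] unfolding labelings_def by auto
    qed
  qed
  then show ?thesis by (simp add: order_series_def)
qed

section \<open>Comparabilities at a bend\<close>

lemma zigzag_bottom: "x < 2 * m + 3 \<Longrightarrow> (2 * m + 3, x) \<in> (zigzag \<beta> m)\<^sup>+"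
proof (induction m arbitrary: x)
  case 0
  have "(3, 1) \<in> zigzag \<beta> 0" "(3, 2) \<in> zigzag \<beta> 0" "(1, 0) \<in> zigzag \<beta> 0"
    by (auto simp: zigzag_def)
  moreover have "x = 0 \<or> x = 1 \<or> x = 2" using 0 by auto
  ultimately show ?case by (auto intro: trancl_into_trancl)
next
  case (Suc m)
  have e: "(2 * m + 5, 2 * m + 3) \<in> zigzag \<beta> (Suc m)" "(2 * m + 5, 2 * m + 4) \<in> zigzag \<beta> (Suc m)"
    by (auto simp: zigzag_Suc)
  consider "x < 2 * m + 3" | "x = 2 * m + 3" | "x = 2 * m + 4" using Suc.prems by fastforce
  then show ?case
  proof cases
    case 1
    then have "(2 * m + 3, x) \<in> (zigzag \<beta> (Suc m))\<^sup>+"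
      using Suc.IH[of x] trancl_mono[OF _ zigzag_mono[of m "Suc m" \<beta>]] by simp
    then have "(2 * m + 5, x) \<in> (zigzag \<beta> (Suc m))\<^sup>+" using e(1) by (rule trancl_into_trancl2[rotated])
    then show ?thesis by (simp add: algebra_simps)
  qed (use e in \<open>auto simp: algebra_simps\<close>)
qed

text \<open>When square \<open>i + 1\<close> is glued along the edge from \<open>2 * i + 1\<close> to \<open>2 * i + 3\<close>, its two
  elements other than these lie below \<open>2 * i + 1\<close>, and all later squares hang below elements
  already numbered at least \<open>2 * i + 3\<close>.\<close>

lemma zigzag_below_pivot:
  assumes "i \<le> m" "i < m \<Longrightarrow> \<beta> (i + 1)" "2 * i + 3 \<le> y" "y \<le> 2 * m + 3"
  shows "(y, 2 * i + 1) \<in> (zigzag \<beta> m)\<^sup>+"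
  using assms(1,2,4,3)
proof (induction m arbitrary: y rule: dec_induct)
  case base
  then have "y = 2 * i + 3" by simp
  then show ?case by (auto simp: zigzag_def)
next
  case (step m)
  have sub: "zigzag \<beta> m \<subseteq> zigzag \<beta> (Suc m)" by (auto simp: zigzag_Suc)
  have old: "(z, 2 * i + 1) \<in> (zigzag \<beta> (Suc m))\<^sup>+" if "2 * i + 3 \<le> z" "z \<le> 2 * m + 3" for z
    using step that trancl_mono[OF _ sub] by (meson less_Suc_eq)
  have e: "(2 * m + 5, 2 * m + 3) \<in> zigzag \<beta> (Suc m)"
    "(2 * m + 4, if \<beta> (Suc m) then 2 * m + 1 else 2 * m + 2) \<in> zigzag \<beta> (Suc m)"
    by (auto simp: zigzag_Suc)
  consider "y \<le> 2 * m + 3" | "y = 2 * m + 4" "m = i" | "y = 2 * m + 4" "i < m" | "y = 2 * m + 5"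
    using step by fastforce
  then show ?case
  proof cases
    case 1 then show ?thesis using old step by blast
  next
    case 2 then show ?thesis using e(2) step by auto
  next
    case 3
    then have "2 * i + 3 \<le> 2 * m + 1" by simp
    then have "(if \<beta> (Suc m) then 2 * m + 1 else 2 * m + 2, 2 * i + 1) \<in> (zigzag \<beta> (Suc m))\<^sup>+"
      using old by simp
    then show ?thesis using e(2) 3 by (auto intro: trancl_into_trancl2)
  next
    case 4
    then show ?thesis using e(1) old[of "2 * m + 3"] step by (auto intro: trancl_into_trancl2)
  qed
qed

text \<open>Numbers decrease along a path, and these two differ by one, so the path would be a single
  cover.\<close>

lemma zigzag_pivot_not_above: "(2 * i + 2, 2 * i + 1) \<notin> (zigzag \<beta> n)\<^sup>+"
proof
  assume "(2 * i + 2, 2 * i + 1) \<in> (zigzag \<beta> n)\<^sup>+"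
  then obtain z where z: "(2 * i + 2, z) \<in> (zigzag \<beta> n)\<^sup>*" "(z, 2 * i + 1) \<in> zigzag \<beta> n"
    by (blast dest: tranclD2)
  have "z = 2 * i + 2"
  proof (rule ccontr)
    assume "z \<noteq> 2 * i + 2"
    then have "(2 * i + 2, z) \<in> (zigzag \<beta> n)\<^sup>+" using z(1) by (auto dest: rtranclD)
    then show False using zigzag_trancl_decreasing zigzag_decreasing[OF z(2)] by fastforce
  qed
  then show False using z(2) by (auto simp: zigzag_def split: if_splits) presburger+
qed

text \<open>At a bend with \<open>1 \<le> i < n\<close> the element \<open>a = 2 * i + 1\<close> belongs to three consecutive squares:
  it is the bottom of the first, a middle element of the second and the top of the third. It is
  therefore comparable to everything except the other middle element \<open>b = 2 * i + 2\<close> of the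
  second. Deciding how the labels of \<open>a\<close> and \<open>b\<close> compare turns \<open>a\<close> into a cut point between what
  is above it and what is below it, and the series factor. The extreme cases are allowed because
  they describe the pieces: for \<open>i = 0\<close> the first square shrinks to its element \<open>0\<close>, for \<open>i = n\<close>
  the third to \<open>2 * n + 3\<close>.\<close>

lemma zigzag_series_pivot:
  assumes "i \<le> n" "i < n \<Longrightarrow> \<beta> (i + 1)"
  defines "S \<equiv> zigzag_series \<beta> n"
  shows "S {0..2 * n + 3} = S ({0..2 * i} \<union> {2 * i + 2}) * S {2 * i + 3..2 * n + 3}
    + S {0..2 * i} * S {2 * i + 2..2 * n + 3} - S {0..2 * i} * S {2 * i + 3..2 * n + 3}"
proof -
  define r where "r = (zigzag \<beta> n)\<^sup>+"
  define a where "a = 2 * i + 1"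
  define b where "b = 2 * i + 2"
  define A where "A = {0..2 * n + 3}"
  define U where "U = {0..2 * i}"
  define D where "D = {2 * i + 3..2 * n + 3}"
  note defs = a_def b_def A_def U_def D_def
  have dec: "y < x" if "(x, y) \<in> r" for x y
    using that unfolding r_def by (rule zigzag_trancl_decreasing)
  have aU: "(a, x) \<in> r" if "x \<in> U" for x
  proof (cases i)
    case 0
    then show ?thesis using that by (auto simp: r_def defs zigzag_def)
  next
    case (Suc j)
    then have a: "a = 2 * j + 3" by (simp add: defs)
    have "(a, x) \<in> (zigzag \<beta> j)\<^sup>+"
      unfolding a using that Suc by (intro zigzag_bottom) (simp add: defs)
    moreover have "zigzag \<beta> j \<subseteq> zigzag \<beta> n"
      using Suc assms(1) by (intro zigzag_mono) auto
    ultimately show ?thesis unfolding r_def by (rule trancl_mono)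
  qed
  have Da: "(y, a) \<in> r" if "y \<in> D" for y
    using that assms zigzag_below_pivot[of i n \<beta> y] by (auto simp: r_def defs)
  have ba: "(b, a) \<notin> r" unfolding r_def defs by (rule zigzag_pivot_not_above)
  have AUD: "A = U \<union> {a} \<union> ({b} \<union> D)" using assms(1) by (auto simp: defs)
  have fin: "finite U" "finite D" by (auto simp: defs)
  have up: "x \<noteq> a \<and> (a, x) \<in> r" if "(b, x) \<in> r" for x
  proof -
    have "x \<noteq> a" "x < b" using that ba dec by auto
    then show ?thesis using aU[of x] by (auto simp: defs)
  qed
  \<comment> \<open>What lies below \<open>b\<close> has a larger number than \<open>b\<close>, so it lies below \<open>a\<close> as well; the preceding
    fact is dual.\<close>
  have down: "x \<noteq> a \<and> (x, a) \<in> r" if "x \<in> A" "(x, b) \<in> r" for x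
    using that dec[OF that(2)] Da[of x] by (auto simp: defs)
  have no_r: "(x, y) \<notin> r" if "x \<le> y" for x y using dec[of x y] that by auto
  have split: "order_series A r = order_series A (insert (a, b) r) + order_series A (insert (b, a) r)
      - order_series (A - {b}) r"
    using up down no_r by (intro order_series_split) (auto simp: AUD fin, auto simp: defs)
  have "order_series A (insert (a, b) r)
      = order_series (U \<union> {b}) (insert (a, b) r) * order_series D (insert (a, b) r)"
    using aU Da ba no_r
    by (intro order_series_ordinal_sum) (auto simp: fin AUD, auto simp: defs)
  also have "\<dots> = order_series (U \<union> {b}) r * order_series D r"
    by (intro arg_cong2[of _ _ _ _ "(*)"] order_series_cong) (auto simp: defs)
  finally have above: "order_series A (insert (a, b) r) = order_series (U \<union> {b}) r * order_series D r" .
  have "order_series A (insert (b, a) r)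
      = order_series U (insert (b, a) r) * order_series ({b} \<union> D) (insert (b, a) r)"
    using aU Da ba no_r
    by (intro order_series_ordinal_sum) (auto simp: fin AUD, auto simp: defs)
  also have "\<dots> = order_series U r * order_series ({b} \<union> D) r"
    by (intro arg_cong2[of _ _ _ _ "(*)"] order_series_cong) (auto simp: defs)
  finally have below: "order_series A (insert (b, a) r) = order_series U r * order_series ({b} \<union> D) r" .
  have equal: "order_series (A - {b}) r = order_series U r * order_series D r"
    using aU Da ba no_r
    by (intro order_series_ordinal_sum) (auto simp: fin AUD, auto simp: defs)
  have "{b} \<union> D = {2 * i + 2..2 * n + 3}" using assms(1) by (auto simp: defs)
  then show ?thesis
    using split above below equal unfolding S_def r_def defs by simp
qed

section \<open>Symmetry, translation and small pieces\<close>

lemma zigzag_series_agree: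
  "(\<And>j. 1 \<le> j \<Longrightarrow> j \<le> n \<Longrightarrow> \<beta> j = \<gamma> j) \<Longrightarrow> zigzag_series \<beta> n {l..2 * n + 3} = zigzag_series \<gamma> n {l..2 * n + 3}"
  by (rule zigzag_series_prefix) auto

text \<open>The first square is symmetric under exchanging its middle elements \<open>1\<close> and \<open>2\<close>, and this
  exchanges the two ways of attaching the second square. So the first letter of a word does not
  matter, and a ladder may be taken to begin with a bend or not, as convenient.\<close>

lemma zigzag_series_first_bend:
  assumes "\<And>j. 2 \<le> j \<Longrightarrow> j \<le> n \<Longrightarrow> \<beta> j = \<gamma> j"
  shows "zigzag_series \<beta> n {0..2 * n + 3} = zigzag_series \<gamma> n {0..2 * n + 3}"
proof (cases "n = 0 \<or> \<beta> 1 = \<gamma> 1")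
  case True
  have "\<beta> j = \<gamma> j" if "1 \<le> j" "j \<le> n" for j
    using that assms[of j] True by (cases "j = 1") auto
  then show ?thesis by (rule zigzag_series_agree)
next
  case False
  define \<phi> :: "nat \<Rightarrow> nat" where "\<phi> = id(1 := 2, 2 := 1)"
  have \<phi>: "\<phi> 0 = 0" "\<phi> 1 = 2" "\<phi> (Suc 0) = 2" "\<phi> 2 = 1" "\<phi> (Suc (Suc 0)) = 1" "\<And>x. 3 \<le> x \<Longrightarrow> \<phi> x = x"
    by (auto simp: \<phi>_def)
  have inv: "\<phi> (\<phi> x) = x" for x by (auto simp: \<phi>_def)
  have inj: "inj \<phi>" by (rule injI) (metis inv)
  have img: "zigzag \<gamma> m = map_prod \<phi> \<phi> ` zigzag \<beta> m" if "m \<le> n" for m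
    using that
  proof (induction m)
    case 0
    then show ?case by (auto simp: zigzag_0 \<phi>)
  next
    case (Suc m)
    show ?case
    proof (cases "m = 0")
      case True
      then show ?thesis
        using Suc False unfolding zigzag_Suc image_Un by (simp add: \<phi> numeral_2_eq_2)
    next
      case m: False
      then have "\<beta> (Suc m) = \<gamma> (Suc m)" using Suc.prems assms by simp
      moreover have "\<phi> (2 * m + 1) = 2 * m + 1" "\<phi> (2 * m + 2) = 2 * m + 2" using m by (auto intro!: \<phi>)
      ultimately show ?thesis
        using Suc unfolding zigzag_Suc image_Un by (simp add: \<phi>)
    qed
  qed
  have "(x, y) \<in> zigzag \<beta> n \<longleftrightarrow> (\<phi> x, \<phi> y) \<in> zigzag \<gamma> n" for x y
    using inj_image_mem_iff[of "map_prod \<phi> \<phi>" "(x, y)" "zigzag \<beta> n"] inj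
    by (simp add: img[OF order_refl] prod.inj_map)
  moreover have "bij_betw \<phi> {0..2 * n + 3} {0..2 * n + 3}"
    by (rule bij_betw_byWitness[where f' = \<phi>]) (auto simp: inv, auto simp: \<phi>_def)
  ultimately show ?thesis
    unfolding zigzag_series_interval by (intro order_series_iso)
qed

lemma zigzag_le: "(x, y) \<in> zigzag \<beta> n \<Longrightarrow> x \<le> 2 * n + 3"
  by (auto simp: zigzag_def)

text \<open>The squares from \<open>i\<close> on are numbered like those of a shorter zigzag, with \<open>2 * i\<close> added.
  This is exact only for \<open>1 \<le> y\<close>: the top \<open>0\<close> would have to go to \<open>2 * i\<close>, whereas square \<open>i\<close> may
  instead hang below \<open>2 * i - 1\<close>.\<close>

lemma zigzag_shift:
  assumes "1 \<le> y"
  shows "(x, y) \<in> zigzag (\<lambda>j. \<beta> (i + j)) k \<longleftrightarrow> (x + 2 * i, y + 2 * i) \<in> zigzag \<beta> (i + k)"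
proof (induction k)
  case 0
  show ?case
  proof (cases i)
    case 0
    then show ?thesis by simp
  next
    case (Suc j)
    have "(x + 2 * Suc j, y + 2 * Suc j) \<notin> zigzag \<beta> j"
      using zigzag_decreasing[of "x + 2 * Suc j" "y + 2 * Suc j" \<beta> j]
        zigzag_le[of "x + 2 * Suc j" "y + 2 * Suc j" \<beta> j] assms by auto
    then show ?thesis
      using assms unfolding Suc zigzag_0 zigzag_Suc add_0_right by auto
  qed
next
  case (Suc k)
  then show ?case by (auto simp: zigzag_Suc algebra_simps)
qed

lemma zigzag_series_shift:
  assumes "1 \<le> l"
  shows "zigzag_series \<beta> (i + k) {l + 2 * i..2 * (i + k) + 3} = zigzag_series (\<lambda>j. \<beta> (i + j)) k {l..2 * k + 3}"
proof -
  have "bij_betw (\<lambda>x. x + 2 * i) {l..2 * k + 3} {l + 2 * i..2 * (i + k) + 3}"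
    by (rule bij_betw_byWitness[where f' = "\<lambda>x. x - 2 * i"]) auto
  moreover have "(x, y) \<in> zigzag (\<lambda>j. \<beta> (i + j)) k \<longleftrightarrow> (x + 2 * i, y + 2 * i) \<in> zigzag \<beta> (i + k)"
    if "y \<in> {l..2 * k + 3}" for x y
    using that assms by (intro zigzag_shift) auto
  ultimately show ?thesis
    unfolding zigzag_series_interval by (intro order_series_iso[symmetric]) auto
qed

lemma zigzag_series_singleton: "zigzag_series \<beta> n {x} = inverse (1 - fps_X) ^ 2"
  using order_series_ordinal_sum[of "{}" "{}" x "(zigzag \<beta> n)\<^sup>+" "{x}"]
  by (simp add: order_series_empty power2_eq_square)

lemma zigzag_series_pair:
  assumes "(x, y) \<in> zigzag \<beta> n"
  shows "zigzag_series \<beta> n {x, y} = inverse (1 - fps_X) ^ 3"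
proof -
  have "y < x" "(y, x) \<notin> (zigzag \<beta> n)\<^sup>+"
    using zigzag_decreasing[OF assms] zigzag_trancl_decreasing[of y x] by auto
  then have "zigzag_series \<beta> n {x, y} = zigzag_series \<beta> n {} * zigzag_series \<beta> n {x}"
    using assms by (intro order_series_ordinal_sum[where a = y]) auto
  then show ?thesis by (simp add: order_series_empty zigzag_series_singleton eval_nat_numeral)
qed

text \<open>The bottom is a cut point with nothing below it; the factor is the series of the empty
  poset.\<close>

lemma zigzag_series_add_bottom:
  "zigzag_series \<beta> n {0..2 * n + 3} = zigzag_series \<beta> n {0..2 * n + 2} * inverse (1 - fps_X)"
proof -
  have b: "(2 * n + 3, x) \<in> (zigzag \<beta> n)\<^sup>+" if "x < 2 * n + 3" for x
    using that by (rule zigzag_bottom)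
  have nb: "(x, 2 * n + 3) \<notin> (zigzag \<beta> n)\<^sup>+" if "x < 2 * n + 3" for x
    using zigzag_trancl_decreasing[of x "2 * n + 3"] that by auto
  have "zigzag_series \<beta> n {0..2 * n + 3} = zigzag_series \<beta> n {0..2 * n + 2} * zigzag_series \<beta> n {}"
    using b nb by (intro order_series_ordinal_sum[where a = "2 * n + 3"]) auto
  then show ?thesis by (simp add: order_series_empty)
qed

lemma zigzag_top:
  assumes "1 \<le> x" "x \<le> 2 * n + 3"
  shows "(x, 0) \<in> (zigzag \<beta> n)\<^sup>+"
  using assms
proof (induction x rule: less_induct)
  case (less x)
  consider "x = 1 \<or> x = 2" | m where "m \<le> n" "x = 2 * m + 3" | m where "1 \<le> m" "m \<le> n" "x = 2 * m + 2"
  proof -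
    have "x = 1 \<or> x = 2 \<or> (\<exists>m\<le>n. x = 2 * m + 3) \<or> (\<exists>m\<ge>1. m \<le> n \<and> x = 2 * m + 2)"
      using less.prems by presburger
    then show ?thesis using that by blast
  qed
  then have "\<exists>y. (x, y) \<in> zigzag \<beta> n"
  proof cases
    case 1
    then show ?thesis by (auto simp: zigzag_def)
  next
    case (2 m)
    then have "(x, 2 * m + 1) \<in> zigzag \<beta> n" by (auto simp: zigzag_def)
    then show ?thesis ..
  next
    case (3 m)
    then have "(x, if \<beta> m then 2 * m - 1 else 2 * m) \<in> zigzag \<beta> n" by (auto simp: zigzag_def)
    then show ?thesis ..
  qed
  then obtain y where y: "(x, y) \<in> zigzag \<beta> n" ..
  show ?case
  proof (cases "y = 0")
    case True
    then show ?thesis using y by auto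
  next
    case False
    moreover have "y < x" using y by (rule zigzag_decreasing)
    ultimately have "(y, 0) \<in> (zigzag \<beta> n)\<^sup>+" using less by auto
    then show ?thesis using y by (rule trancl_into_trancl2[rotated])
  qed
qed

lemma zigzag_series_add_top:
  "zigzag_series \<beta> n {0..2 * n + 3} = inverse (1 - fps_X) * zigzag_series \<beta> n {1..2 * n + 3}"
proof -
  have nb: "(0, x) \<notin> (zigzag \<beta> n)\<^sup>+" for x
    using zigzag_trancl_decreasing[of 0 x] by auto
  have "zigzag_series \<beta> n {0..2 * n + 3} = zigzag_series \<beta> n {} * zigzag_series \<beta> n {1..2 * n + 3}"
    using nb zigzag_top by (intro order_series_ordinal_sum[where a = 0]) auto
  then show ?thesis by (simp add: order_series_empty)
qed

section \<open>The four pieces around the last bend\<close>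

text \<open>The prefix that ends with square \<open>i\<close> consists of the part above the pivot \<open>a\<close>, of \<open>a\<close> and
  \<open>b\<close>, and of a single point below both. The factorization at \<open>a\<close> therefore expresses its series
  by the two upper factors of the longer zigzag, the lower factors being chains with one and two
  points. In the prefix that is shorter by one square, \<open>a\<close> is the bottom.\<close>

lemma zigzag_series_pivot_top:
  fixes \<beta> :: "nat \<Rightarrow> bool" and i n :: nat
  defines "e \<equiv> inverse (1 - fps_X) :: real fps"
  assumes "1 \<le> i" "i \<le> n"
  shows "zigzag_series \<beta> i {0..2 * i + 3} = e ^ 2 * zigzag_series \<beta> n ({0..2 * i} \<union> {2 * i + 2})
     + (e ^ 3 - e ^ 2) * zigzag_series \<beta> n {0..2 * i}"
    and "zigzag_series \<beta> (i - 1) {0..2 * (i - 1) + 3} = e * zigzag_series \<beta> n {0..2 * i}"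
proof -
  have "zigzag_series \<beta> i {0..2 * i} = zigzag_series \<beta> n {0..2 * i}"
      "zigzag_series \<beta> i ({0..2 * i} \<union> {2 * i + 2}) = zigzag_series \<beta> n ({0..2 * i} \<union> {2 * i + 2})"
    using assms(3) by (auto intro!: zigzag_series_prefix[symmetric])
  moreover have "{2 * i + 2..2 * i + 3} = {2 * i + 3, 2 * i + 2}" by auto
  moreover have "(2 * i + 3, 2 * i + 2) \<in> zigzag \<beta> i" by (auto simp: zigzag_def)
  ultimately show "zigzag_series \<beta> i {0..2 * i + 3} = e ^ 2 * zigzag_series \<beta> n ({0..2 * i} \<union> {2 * i + 2})
     + (e ^ 3 - e ^ 2) * zigzag_series \<beta> n {0..2 * i}"
    using zigzag_series_pivot[of i i \<beta>] zigzag_series_singleton[of "2 * i + 3" \<beta> i] zigzag_series_pair[of "2 * i + 3" "2 * i + 2" \<beta> i]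
    by (simp add: e_def algebra_simps)
  have "2 * (i - 1) + 2 = 2 * i" using assms(2) by simp
  moreover have "zigzag_series \<beta> (i - 1) {0..2 * i} = zigzag_series \<beta> n {0..2 * i}"
    using assms(2,3) by (auto intro!: zigzag_series_prefix[symmetric])
  ultimately show "zigzag_series \<beta> (i - 1) {0..2 * (i - 1) + 3} = e * zigzag_series \<beta> n {0..2 * i}"
    using zigzag_series_add_bottom[of "i - 1" \<beta>] by (simp add: e_def mult.commute)
qed

text \<open>Dual to the preceding lemma. The squares from \<open>i\<close> on form a ladder with \<open>k + 1\<close> squares,
  which contains a single point of the part above the pivot; the squares from \<open>i + 1\<close> on form a
  ladder with \<open>k\<close> squares whose top is the pivot. The ladder \<open>\<gamma>\<close> is left free to bend at its first
  letter, since a sub-ladder may consist of either letter.\<close>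

lemma zigzag_series_ladder:
  fixes \<beta> \<gamma> :: "nat \<Rightarrow> bool" and i k :: nat
  defines "e \<equiv> inverse (1 - fps_X) :: real fps"
  assumes k: "1 \<le> k" and bend: "\<beta> (i + 1)"
    and straight: "\<And>j. i + 2 \<le> j \<Longrightarrow> j \<le> i + k \<Longrightarrow> \<not> \<beta> j"
    and \<gamma>: "\<And>j. 2 \<le> j \<Longrightarrow> j \<le> k \<Longrightarrow> \<not> \<gamma> j"
  shows "zigzag_series \<gamma> k {0..2 * k + 3} = e ^ 2 * zigzag_series \<beta> (i + k) {2 * i + 2..2 * (i + k) + 3}
     + (e ^ 3 - e ^ 2) * zigzag_series \<beta> (i + k) {2 * i + 3..2 * (i + k) + 3}" (is ?thesis1)
    and "zigzag_series \<gamma> (k - 1) {0..2 * (k - 1) + 3} = e * zigzag_series \<beta> (i + k) {2 * i + 3..2 * (i + k) + 3}"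
      (is ?thesis2)
proof -
  \<comment> \<open>The ladder that bends at its first letter: it has its pivot at 1, as the tail of the zigzag
    does at \<open>2 * i + 1\<close>.\<close>
  define \<tau> where "\<tau> j = (j = 1)" for j :: nat
  have "zigzag_series \<beta> (i + k) {2 + 2 * i..2 * (i + k) + 3} = zigzag_series (\<lambda>j. \<beta> (i + j)) k {2..2 * k + 3}"
    by (rule zigzag_series_shift) simp
  also have "\<dots> = zigzag_series \<tau> k {2..2 * k + 3}"
  proof (rule zigzag_series_agree)
    fix j assume "1 \<le> j" "j \<le> k"
    then show "\<beta> (i + j) = \<tau> j" using bend straight[of "i + j"] by (cases "j = 1") (auto simp: \<tau>_def)
  qed
  finally have DB: "zigzag_series \<beta> (i + k) {2 * i + 2..2 * (i + k) + 3} = zigzag_series \<tau> k {2..2 * k + 3}"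
    by (simp add: add.commute)
  \<comment> \<open>Strictly below the pivot only squares from \<open>m + 1\<close> on remain, all glued straight, so the bend
    at \<open>m + 1\<close> is no longer visible.\<close>
  have shift3: "zigzag_series \<alpha> (m + k) {2 * m + 3..2 * (m + k) + 3} = zigzag_series (\<lambda>_. False) (k - 1) {1..2 * (k - 1) + 3}"
    if "\<And>j. m + 2 \<le> j \<Longrightarrow> j \<le> m + k \<Longrightarrow> \<not> \<alpha> j" for \<alpha> m
  proof -
    have eq: "(m + 1) + (k - 1) = m + k" "1 + 2 * (m + 1) = 2 * m + 3" using k by auto
    have "zigzag_series \<alpha> (m + k) {2 * m + 3..2 * (m + k) + 3}
        = zigzag_series (\<lambda>j. \<alpha> ((m + 1) + j)) (k - 1) {1..2 * (k - 1) + 3}"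
      using zigzag_series_shift[of 1 "m + 1" "k - 1" \<alpha>] unfolding eq by simp
    also have "\<dots> = zigzag_series (\<lambda>_. False) (k - 1) {1..2 * (k - 1) + 3}"
      using that k by (intro zigzag_series_agree) auto
    finally show ?thesis .
  qed
  have D: "zigzag_series \<tau> k {3..2 * k + 3} = zigzag_series \<beta> (i + k) {2 * i + 3..2 * (i + k) + 3}"
    using shift3[of i \<beta>] shift3[of 0 \<tau>] straight by (simp add: \<tau>_def)
  have "zigzag_series \<gamma> k {0..2 * k + 3} = zigzag_series \<tau> k {0..2 * k + 3}"
    using \<gamma> by (intro zigzag_series_first_bend) (auto simp: \<tau>_def)
  also have "\<dots> = zigzag_series \<tau> k {2, 0} * zigzag_series \<tau> k {3..2 * k + 3}
      + zigzag_series \<tau> k {0} * zigzag_series \<tau> k {2..2 * k + 3} - zigzag_series \<tau> k {0} * zigzag_series \<tau> k {3..2 * k + 3}"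
    using zigzag_series_pivot[of 0 k \<tau>, unfolded mult_0_right add_0 atLeastAtMost_singleton]
    by (simp add: \<tau>_def insert_commute)
  also have "zigzag_series \<tau> k {2, 0} = e ^ 3"
    unfolding e_def by (rule zigzag_series_pair) (simp add: zigzag_def)
  also have "zigzag_series \<tau> k {0} = e ^ 2"
    unfolding e_def by (rule zigzag_series_singleton)
  finally show ?thesis1 unfolding D DB by (simp only: algebra_simps)
  have "zigzag_series \<gamma> (k - 1) {0..2 * (k - 1) + 3} = zigzag_series (\<lambda>_. False) (k - 1) {0..2 * (k - 1) + 3}"
    using \<gamma> by (intro zigzag_series_first_bend) auto
  then show ?thesis2
    using zigzag_series_add_top[of "k - 1" "\<lambda>_. False"] shift3[of i \<beta>] straight by (simp add: e_def)
qed

section \<open>Words\<close>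

lemma subword_0: "j < length w \<Longrightarrow> subword w 0 j = take (Suc j) w"
  by (rule nth_equalityI) (auto simp: subword_def simp del: upt_Suc)

lemma h_star_zigzag:
  assumes "snake_word w" "snake_length w = n"
  shows "fps_of_poly (h_star w) = zigzag_series (bends w) n {0..2 * n + 3} * (1 - fps_X) ^ (2 * n + 5)"
  using assms unfolding h_star_eq
  by (simp add: add.commute snake_carrier_def snake_less_def snake_covers_upto_eq_zigzag)

text \<open>The rightmost maximal sub-ladder starts at the least position from which on the word is
  constant. The letter before this position differs because the position is least, whereas any
  later start would be preceded by an equal letter. If the position were \<open>1\<close>, the word would be a
  ladder.\<close>

lemma last_ladder_start_props:
  assumes w: "snake_word w" and nl: "\<not> ladder_word w"
  obtains i k where "1 \<le> i" "1 \<le> k" "snake_length w = i + k" "last_ladder_start w = i + 1"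
    "\<And>j. i + 1 \<le> j \<Longrightarrow> j \<le> i + k \<Longrightarrow> w ! j = w ! (i + 1)" "w ! i \<noteq> w ! (i + 1)"
proof -
  define n where "n = snake_length w"
  have w0: "w ! 0 = Eps" and wn: "\<And>j. 1 \<le> j \<Longrightarrow> j \<le> n \<Longrightarrow> w ! j \<noteq> Eps"
    using w by (force simp: snake_word_def n_def)+
  have n1: "1 \<le> n" using w nl by (auto simp: ladder_word_def n_def)
  define P where "P s \<longleftrightarrow> 1 \<le> s \<and> s \<le> n \<and> (\<forall>j\<in>{s..n}. w ! j = w ! n)" for s
  define s where "s = (LEAST s. P s)"
  have "P n" using n1 by (auto simp: P_def)
  then have Ps: "P s" unfolding s_def by (rule LeastI)
  have min: "s \<le> t" if "P t" for t unfolding s_def using that by (rule Least_le)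
  have s: "1 \<le> s" "s \<le> n" and const: "\<And>j. s \<le> j \<Longrightarrow> j \<le> n \<Longrightarrow> w ! j = w ! n"
    using Ps unfolding P_def by (blast intro: atLeastAtMost_iff[THEN iffD2])+
  have ne: "w ! (s - 1) \<noteq> w ! s"
  proof
    assume eq: "w ! (s - 1) = w ! s"
    have "w ! s \<noteq> Eps" using s by (rule wn)
    then have "s \<noteq> 1" using eq w0 by (metis diff_self_eq_0)
    then have s': "1 \<le> s - 1" "s - 1 \<le> n" using s by simp_all
    have "w ! j = w ! n" if "j \<in> {s - 1..n}" for j
    proof (cases "j = s - 1")
      case True
      then show ?thesis using eq const[OF order_refl s(2)] by metis
    next
      case False
      then show ?thesis using that by (intro const) auto
    qed
    then have "P (s - 1)" unfolding P_def using s' by blast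
    from min[OF this] show False using s by simp
  qed
  have "s \<noteq> 1"
  proof
    assume "s = 1"
    then have "w ! j = w ! l" if "j \<in> {1..n}" "l \<in> {1..n}" for j l
      using that const[of j] const[of l] by simp
    then have "ladder_word w" using w unfolding ladder_word_def n_def by blast
    then show False using nl by simp
  qed
  have "last_ladder_start w = s"
    unfolding last_ladder_start_def
  proof (rule Greatest_equality)
    have "w ! j = w ! l" if "j \<in> {s..n}" "l \<in> {s..n}" for j l
      using that const[of j] const[of l] by simp
    then have "maximal_subladder w s n"
      using s ne unfolding maximal_subladder_def n_def by blast
    then show "\<exists>j. maximal_subladder w s j" ..
    fix t assume "\<exists>j. maximal_subladder w t j"
    then have t: "w ! (t - 1) \<noteq> w ! t" "t \<le> n" by (auto simp: maximal_subladder_def n_def)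
    show "t \<le> s"
    proof (rule ccontr)
      assume "\<not> t \<le> s"
      then have "s \<le> t - 1" "s \<le> t" "t - 1 \<le> n" using t(2) by simp_all
      then have "w ! (t - 1) = w ! n" "w ! t = w ! n" using t(2) by (auto intro!: const)
      then show False using t(1) by simp
    qed
  qed
  moreover have eq: "s - 1 + 1 = s" "s - 1 + (n - s + 1) = n" using s by simp_all
  moreover have "w ! j = w ! s" if "s \<le> j" "j \<le> n" for j
    using const[OF that] const[OF order_refl s(2)] by metis
  moreover have "1 \<le> s - 1" "1 \<le> n - s + 1" using s \<open>s \<noteq> 1\<close> by simp_all
  ultimately show thesis
    using that[of "s - 1" "n - s + 1", unfolded eq] ne n_def by blast
qed

lemma snake_word_take:
  assumes w: "snake_word w"
  shows "snake_word (take (Suc m) w)"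
proof -
  have "take (Suc m) w ! j \<in> {L, R}" if "j \<in> {1..snake_length (take (Suc m) w)}" for j
  proof -
    have "j \<in> {1..snake_length w}" "j < Suc m" using that by (auto simp: snake_length_def)
    then show ?thesis using w unfolding snake_word_def by (metis nth_take)
  qed
  then show ?thesis using w unfolding snake_word_def by simp
qed

lemma drop_last_eq_take:
  assumes "1 \<le> snake_length u"
  shows "drop_last u = take (snake_length u) u"
  using assms unfolding drop_last_def by (subst subword_0) (auto simp: snake_length_def Suc_diff_Suc)

lemma bends_take: "j \<le> m \<Longrightarrow> bends (take (Suc m) w) j \<longleftrightarrow> bends w j"
  by (cases "j = 1") (auto simp: bends_def)

lemma h_star_prefix:
  assumes "snake_word w" "m \<le> snake_length w"
  shows "fps_of_poly (h_star (take (Suc m) w))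
    = zigzag_series (bends w) m {0..2 * m + 3} * (1 - fps_X) ^ (2 * m + 5)"
proof -
  have "snake_length (take (Suc m) w) = m"
    using assms by (auto simp: snake_length_def snake_word_def)
  then have "fps_of_poly (h_star (take (Suc m) w))
      = zigzag_series (bends (take (Suc m) w)) m {0..2 * m + 3} * (1 - fps_X) ^ (2 * m + 5)"
    using snake_word_take[OF assms(1)] by (intro h_star_zigzag) auto
  also have "zigzag_series (bends (take (Suc m) w)) m {0..2 * m + 3} = zigzag_series (bends w) m {0..2 * m + 3}"
    by (rule zigzag_series_agree) (simp add: bends_take)
  finally show ?thesis .
qed

text \<open>The pivot factorization applies with \<open>a = 1\<close> and \<open>b = 2\<close>, and with single points above and
  below.\<close>

lemma h_star_empty_word: "h_star [Eps] = [:1, 1:]"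
proof -
  define y where "y = (1 - fps_X :: real fps)"
  define e where "e = inverse y"
  have ye: "y * e = 1" unfolding e_def y_def by (rule inverse_mult_eq_1') simp
  let ?S = "zigzag_series (bends [Eps]) 0"
  have sing: "?S {x} = e ^ 2" for x unfolding e_def y_def by (rule zigzag_series_singleton)
  have "?S {2, 0} = e ^ 3" "?S {3, 2} = e ^ 3"
    unfolding e_def y_def by (rule zigzag_series_pair, simp add: zigzag_0)+
  moreover have "{2..3} = {3, 2 :: nat}" by auto
  ultimately have S: "?S {0..3} = 2 * (e ^ 2 * e ^ 3) - e ^ 2 * e ^ 2"
    using zigzag_series_pivot[of 0 0 "bends [Eps]", unfolded mult_0_right add_0 atLeastAtMost_singleton] by (simp add: sing insert_commute)
  have "fps_of_poly (h_star [Eps]) = ?S {0..3} * y ^ 5"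
    using h_star_zigzag[of "[Eps]" 0] by (simp add: snake_word_def snake_length_def y_def)
  also have "\<dots> = 2 * (y * e) ^ 5 - (y * e) ^ 4 * y"
    unfolding S by (simp add: power_mult_distrib algebra_simps power_add[symmetric] eval_nat_numeral)
  also have "\<dots> = 2 - y" unfolding ye by simp
  also have "\<dots> = 1 + fps_X" by (simp add: y_def)
  also have "\<dots> = fps_of_poly [:1, 1:]" by (simp add: fps_of_poly_linear)
  finally show ?thesis by (simp add: fps_of_poly_eq_iff)
qed

theorem theorem4p14:
  fixes w q :: "letter list"
  assumes "snake_word w"
    and "\<not> ladder_word w"
    and "q = Eps # last_ladder w"
  shows "h_star w =
           h_star (drop_last (star w)) * h_star q
           + h_star (star w) * h_star (drop_last q)
           - [:1, 1:] * h_star (drop_last (star w)) * h_star (drop_last q)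
         \<and> h_star [Eps] = [:1, 1:]"
proof
  from last_ladder_start_props[OF assms(1,2)] obtain i k where
    i: "1 \<le> i" and k: "1 \<le> k" and n: "snake_length w = i + k" and start: "last_ladder_start w = i + 1"
    and const: "\<And>j. i + 1 \<le> j \<Longrightarrow> j \<le> i + k \<Longrightarrow> w ! j = w ! (i + 1)" and turn: "w ! i \<noteq> w ! (i + 1)"
    by blast
  have len: "length w = i + k + 1"
    using n k by (simp add: snake_length_def)
  define \<beta> where "\<beta> = bends w"
  have bend: "\<beta> (i + 1)" using turn i by (simp add: \<beta>_def bends_def)
  have straight: "\<not> \<beta> j" if "i + 2 \<le> j" "j \<le> i + k" for j
    using that const[of j] const[of "j - 1"] by (simp add: \<beta>_def bends_def)
  have q_eq: "q = Eps # map ((!) w) [i + 1..<Suc (i + k)]"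
    by (simp only: assms(3) last_ladder_def subword_def start n)
  have q_len: "snake_length q = k" by (simp add: q_eq snake_length_def)
  have q_nth: "q ! j = w ! (i + j)" if "1 \<le> j" "j \<le> k" for j
    using that by (simp add: q_eq nth_Cons' del: upt_Suc)
  have q_word: "snake_word q"
  proof -
    have "w ! j \<in> {L, R}" if "1 \<le> j" "j \<le> i + k" for j
      using that assms(1) n by (auto simp: snake_word_def)
    then show ?thesis using q_nth i by (auto simp: snake_word_def q_len) (auto simp: q_eq)
  qed
  have q_straight: "\<not> bends q j" if "2 \<le> j" "j \<le> k" for j
    using that q_nth[of j] q_nth[of "j - 1"] const[of "i + j"] const[of "i + (j - 1)"]
    by (simp add: bends_def)
  have star_eq: "star w = take (Suc i) w"
    unfolding star_def start by (subst subword_0) (auto simp: len)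
  have star_len: "snake_length (star w) = i" by (simp add: star_eq snake_length_def len)
  have star'_eq: "drop_last (star w) = take (Suc (i - 1)) w"
    using i drop_last_eq_take[of "star w", unfolded star_len] by (simp add: star_eq min_def)
  have q'_eq: "drop_last q = take (Suc (k - 1)) q"
    using k drop_last_eq_take[of q, unfolded q_len] by simp
  define y where "y = (1 - fps_X :: real fps)"
  define e where "e = inverse y"
  have ye: "y * e = 1" unfolding e_def y_def by (rule inverse_mult_eq_1') simp
  define u where "u = zigzag_series \<beta> (i + k) {0..2 * i}"
  define u' where "u' = zigzag_series \<beta> (i + k) ({0..2 * i} \<union> {2 * i + 2})"
  define d where "d = zigzag_series \<beta> (i + k) {2 * i + 3..2 * (i + k) + 3}"
  define d' where "d' = zigzag_series \<beta> (i + k) {2 * i + 2..2 * (i + k) + 3}"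
  \<comment> \<open>Every power of \<open>y\<close> that clears a denominator is a product of \<open>A\<close>, \<open>K\<close> and a fixed power, so
    that the final identity has no variable exponents.\<close>
  define A where "A = y ^ (2 * i)"
  define K where "K = y ^ (2 * k)"
  have pow: "y ^ (2 * (i + k) + 5) = A * K * y ^ 5" "y ^ (2 * i + 5) = A * y ^ 5"
      "y ^ (2 * k + 5) = K * y ^ 5" "y ^ (2 * (i - 1) + 5) = A * y ^ 3" "y ^ (2 * (k - 1) + 5) = K * y ^ 3"
    using i k by (simp_all add: A_def K_def power_add[symmetric] algebra_simps)
  have zw: "zigzag_series \<beta> (i + k) {0..2 * (i + k) + 3} = u' * d + u * d' - u * d"
    unfolding u_def u'_def d_def d'_def using bend by (intro zigzag_series_pivot) simp_all
  have h_w: "fps_of_poly (h_star w) = (u' * d + u * d' - u * d) * (A * K * y ^ 5)"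
    using h_star_zigzag[OF assms(1) n, folded \<beta>_def y_def] unfolding zw pow .
  have zs: "zigzag_series \<beta> i {0..2 * i + 3} = e ^ 2 * u' + (e ^ 3 - e ^ 2) * u"
    unfolding u_def u'_def e_def y_def using i by (intro zigzag_series_pivot_top) simp_all
  have h_star: "fps_of_poly (h_star (star w)) = (e ^ 2 * u' + (e ^ 3 - e ^ 2) * u) * (A * y ^ 5)"
    using h_star_prefix[OF assms(1), of i, folded \<beta>_def y_def] n unfolding zs pow star_eq by simp
  have zs': "zigzag_series \<beta> (i - 1) {0..2 * (i - 1) + 3} = e * u"
    unfolding u_def e_def y_def using i by (intro zigzag_series_pivot_top) simp_all
  have h_star': "fps_of_poly (h_star (drop_last (star w))) = e * u * (A * y ^ 3)"
    using h_star_prefix[OF assms(1), of "i - 1", folded \<beta>_def y_def] n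
    unfolding zs' pow star'_eq by simp
  have zq: "zigzag_series (bends q) k {0..2 * k + 3} = e ^ 2 * d' + (e ^ 3 - e ^ 2) * d"
    unfolding d_def d'_def e_def y_def using k bend straight q_straight
    by (intro zigzag_series_ladder(1)) simp_all
  have h_q: "fps_of_poly (h_star q) = (e ^ 2 * d' + (e ^ 3 - e ^ 2) * d) * (K * y ^ 5)"
    using h_star_zigzag[OF q_word q_len, folded y_def] unfolding zq pow .
  have zq': "zigzag_series (bends q) (k - 1) {0..2 * (k - 1) + 3} = e * d"
    unfolding d_def e_def y_def using k bend straight q_straight
    by (intro zigzag_series_ladder(2)) simp_all
  have h_q': "fps_of_poly (h_star (drop_last q)) = e * d * (K * y ^ 3)"
    using h_star_prefix[OF q_word, of "k - 1", folded y_def] q_len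
    unfolding zq' pow q'_eq by simp
  have lin: "fps_of_poly [:1, 1:] = 2 - y"
    by (simp add: y_def fps_of_poly_linear)
  \<comment> \<open>After expansion only the terms with \<open>u * d\<close> do not match at once; they agree because \<open>1 + z =
    2 - y\<close>.\<close>
  have "fps_of_poly (h_star w) = fps_of_poly (h_star (drop_last (star w)) * h_star q
      + h_star (star w) * h_star (drop_last q)
      - [:1, 1:] * h_star (drop_last (star w)) * h_star (drop_last q))"
    unfolding fps_of_poly_diff fps_of_poly_add fps_of_poly_mult h_w h_star h_star' h_q h_q' lin
    using ye by algebra
  then show "h_star w = h_star (drop_last (star w)) * h_star q
      + h_star (star w) * h_star (drop_last q)
      - [:1, 1:] * h_star (drop_last (star w)) * h_star (drop_last q)"
    by (simp only: fps_of_poly_eq_iff)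
  show "h_star [Eps] = [:1, 1:]" by (rule h_star_empty_word)
qed

end
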